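(* Let $A$ be an algebra over a field $F$ with $\mathrm{char}(F)\neq 2$. (i) An axis $a\in A$ of Jordan type $(\lambda,\delta)$ lies in $C(A)$ if and only if either $A_{\lambda,\delta}(a)=0$ or $\lambda=\delta$. (ii) Let $a\neq b$ be two axes in $A$ with $ab=ba$ and with $a$ of type $(\lambda,\delta)$, and let $b_{\lambda,\delta}$ denote the component of $b$ in $A_{\lambda,\delta}(a)$ in the 2-sided decomposition of $b$ with respect to $a$. Then either $ab=0$ and $b_{\lambda,\delta}=0$, or $\lambda=\delta$. In particular, if $a$ is of Jordan type, then either $a\in C(A)$ or $ab=0$.
   Context: Algebras are not necessarily associative, commutative or unital. $C(A)=\{x\in A: xy=yx \text{ for all } y\in A\}$. For $a\in A$ put $L_a(x)=ax$, $R_a(x)=xa$; for $X\in\{L,R\}$ let $A_\lambda(X_a)=\{v: X_a(v)=\lambda v\}$, write $A_\lambda=A_\lambda(L_a)$, and $A_{\lambda,\delta}(a)=A_\lambda(L_a)\cap A_\delta(R_a)$ (written $A_{\lambda,\delta}$ when $a$ is understood). Let $a$ be an idempotent ($a^2=a$) and $\lambda,\delta\in F\setminus\{0,1\}$. $a$ is a left axis of type $\lambda$ if: (a) $A_1(L_a)=Fa$; (b) $(L_a-\lambda)(L_a-1)L_a=0$; (c) the decomposition $A=(A_0\oplus A_1)\oplus A_\lambda$ (eigenspaces of $L_a$) is a $\mathbb Z_2$-grading of $A$ with $+$-part $A_0\oplus A_1$ and $-$-part $A_\lambda$. ($A_0$ is not required to be a subalgebra.) A right axis of type $\delta$ is defined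 similarly using $R_a$. $a$ is an axis of type $(\lambda,\delta)$ if it is a left axis of type $\lambda$, a right axis of type $\delta$, and $L_aR_a=R_aL_a$. Then $A=Fa\oplus A_{0,0}\oplus A_{0,\delta}\oplus A_{\lambda,0}\oplus A_{\lambda,\delta}$, and the corresponding expression $x=\alpha_x a+x_{0,0}+x_{0,\delta}+x_{\lambda,0}+x_{\lambda,\delta}$ ($\alpha_x\in F$, $x_{\gamma,\rho}\in A_{\gamma,\rho}$) is called the 2-sided decomposition of $x$ with respect to $a$. An axis $a$ of type $(\lambda,\delta)$ is of Jordan type $(\lambda,\delta)$ if $A_{\lambda,0}=A_{0,\delta}=0$. *)

theory Defs
  imports Complex_Main "HOL-Library.Set_Algebras"
begin

locale nonassoc_algebra = vector_space scale
  for scale :: "'f::field \<Rightarrow> 'a::ab_group_add \<Rightarrow> 'a" (infixr \<open>*s\<close> 75) +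
  fixes mult :: "'a \<Rightarrow> 'a \<Rightarrow> 'a" (infixl \<open>\<cdot>\<close> 70)
  assumes mult_add_left: "(x + y) \<cdot> z = x \<cdot> z + y \<cdot> z"
    and mult_add_right: "x \<cdot> (y + z) = x \<cdot> y + x \<cdot> z"
    and mult_scale_left: "(c *s x) \<cdot> y = c *s (x \<cdot> y)"
    and mult_scale_right: "x \<cdot> (c *s y) = c *s (x \<cdot> y)"
begin

text \<open>Commutativity only: elements are not required to associate with everything.\<close>

definition commutative_center :: "'a set"
  where "commutative_center = {x. \<forall>y. x \<cdot> y = y \<cdot> x}"

definition Lmul :: "'a \<Rightarrow> 'a \<Rightarrow> 'a"
  where "Lmul a x = a \<cdot> x"

definition Rmul :: "'a \<Rightarrow> 'a \<Rightarrow> 'a"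
  where "Rmul a x = x \<cdot> a"

definition eigenspace :: "('a \<Rightarrow> 'a) \<Rightarrow> 'f \<Rightarrow> 'a set"
  where "eigenspace X l = {v. X v = l *s v}"

definition eigenspace2 :: "'a \<Rightarrow> 'f \<Rightarrow> 'f \<Rightarrow> 'a set"
  where "eigenspace2 a l d = eigenspace (Lmul a) l \<inter> eigenspace (Rmul a) d"

definition internal_direct_sum :: "'a set \<Rightarrow> 'a set \<Rightarrow> 'a set \<Rightarrow> bool"
  where "internal_direct_sum W U V \<longleftrightarrow>
    subspace U \<and> subspace V \<and> W = U + V \<and> U \<inter> V = {0}"

definition Z2_grading :: "'a set \<Rightarrow> 'a set \<Rightarrow> bool"
  where "Z2_grading P M \<longleftrightarrow>
    internal_direct_sum UNIV P M \<and>
    (\<forall>x\<in>P. \<forall>y\<in>P. x \<cdot> y \<in> P) \<and>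
    (\<forall>x\<in>P. \<forall>y\<in>M. x \<cdot> y \<in> M) \<and>
    (\<forall>x\<in>M. \<forall>y\<in>P. x \<cdot> y \<in> M) \<and>
    (\<forall>x\<in>M. \<forall>y\<in>M. x \<cdot> y \<in> P)"

text \<open>The conditions common to left axes (\<open>X = Lmul a\<close>) and right axes (\<open>X = Rmul a\<close>).
  An idempotent is any \<open>a\<close> with \<open>a \<cdot> a = a\<close>; \<open>a = 0\<close> is not excluded.\<close>

definition one_sided_axis :: "('a \<Rightarrow> 'a) \<Rightarrow> 'a \<Rightarrow> 'f \<Rightarrow> bool"
  where "one_sided_axis X a l \<longleftrightarrow>
    a \<cdot> a = a \<and> l \<noteq> 0 \<and> l \<noteq> 1 \<and>
    eigenspace X 1 = range (\<lambda>c. c *s a) \<and>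
    (\<lambda>v. X v - l *s v) \<circ> (\<lambda>v. X v - v) \<circ> X = (\<lambda>v. 0) \<and>
    internal_direct_sum (eigenspace X 0 + eigenspace X 1) (eigenspace X 0) (eigenspace X 1) \<and>
    Z2_grading (eigenspace X 0 + eigenspace X 1) (eigenspace X l)"

definition left_axis :: "'a \<Rightarrow> 'f \<Rightarrow> bool"
  where "left_axis a l \<longleftrightarrow> one_sided_axis (Lmul a) a l"

definition right_axis :: "'a \<Rightarrow> 'f \<Rightarrow> bool"
  where "right_axis a d \<longleftrightarrow> one_sided_axis (Rmul a) a d"

definition axis_of_type :: "'a \<Rightarrow> 'f \<Rightarrow> 'f \<Rightarrow> bool"
  where "axis_of_type a l d \<longleftrightarrow>
    left_axis a l \<and> right_axis a d \<and> Lmul a \<circ> Rmul a = Rmul a \<circ> Lmul a"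

definition axis :: "'a \<Rightarrow> bool"
  where "axis a \<longleftrightarrow> (\<exists>l d. axis_of_type a l d)"

definition axis_of_jordan_type :: "'a \<Rightarrow> 'f \<Rightarrow> 'f \<Rightarrow> bool"
  where "axis_of_jordan_type a l d \<longleftrightarrow>
    axis_of_type a l d \<and> eigenspace2 a l 0 = {0} \<and> eigenspace2 a 0 d = {0}"

definition two_sided_decomposition ::
    "'a \<Rightarrow> 'f \<Rightarrow> 'f \<Rightarrow> 'a \<Rightarrow> 'f \<Rightarrow> 'a \<Rightarrow> 'a \<Rightarrow> 'a \<Rightarrow> 'a \<Rightarrow> bool"
  where "two_sided_decomposition a l d x \<alpha> x00 x0d xl0 xld \<longleftrightarrow>
    x00 \<in> eigenspace2 a 0 0 \<and> x0d \<in> eigenspace2 a 0 d \<and>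
    xl0 \<in> eigenspace2 a l 0 \<and> xld \<in> eigenspace2 a l d \<and>
    x = \<alpha> *s a + x00 + x0d + xl0 + xld"

text \<open>The component of \<open>x\<close> in \<open>eigenspace2 a l d\<close>; it is well defined for every axis of
  type \<open>(l, d)\<close>, see \<open>ex1_component_ld\<close> below.\<close>

definition component_ld :: "'a \<Rightarrow> 'f \<Rightarrow> 'f \<Rightarrow> 'a \<Rightarrow> 'a"
  where "component_ld a l d x =
    (THE xld. \<exists>\<alpha> x00 x0d xl0. two_sided_decomposition a l d x \<alpha> x00 x0d xl0 xld)"

lemma Lmul_linear:
  "Lmul a (x + y) = Lmul a x + Lmul a y" "Lmul a (c *s x) = c *s Lmul a x"
  by (simp_all add: Lmul_def mult_add_right mult_scale_right)

lemma Rmul_linear: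
  "Rmul a (x + y) = Rmul a x + Rmul a y" "Rmul a (c *s x) = c *s Rmul a x"
  by (simp_all add: Rmul_def mult_add_left mult_scale_left)

lemma one_sided_axis_decompose:
  assumes "one_sided_axis X a l"
  obtains \<alpha> u v where "u \<in> eigenspace X 0" "v \<in> eigenspace X l" "x = \<alpha> *s a + u + v"
proof -
  have E1: "eigenspace X 1 = range (\<lambda>c. c *s a)"
    using assms unfolding one_sided_axis_def by (elim conjE)
  have "Z2_grading (eigenspace X 0 + eigenspace X 1) (eigenspace X l)"
    using assms unfolding one_sided_axis_def by (elim conjE)
  then have "UNIV = (eigenspace X 0 + eigenspace X 1) + eigenspace X l"
    unfolding Z2_grading_def internal_direct_sum_def by (elim conjE)
  then have "x \<in> (eigenspace X 0 + eigenspace X 1) + eigenspace X l" by auto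
  then obtain u w v where u: "u \<in> eigenspace X 0" and w: "w \<in> eigenspace X 1"
    and v: "v \<in> eigenspace X l" and x: "x = (u + w) + v"
    unfolding set_plus_def by blast
  from w E1 obtain \<alpha> where "w = \<alpha> *s a" by blast
  with x have "x = \<alpha> *s a + u + v" by (simp add: ac_simps)
  with u v show thesis by (rule that)
qed

lemma eigen_sum_zero:
  assumes add: "\<And>x y. X (x + y) = X x + X y"
    and scale: "\<And>c x. X (c *s x) = c *s X x"
    and "X p = p" "X q = 0" "X r = l *s r" "p + q + r = 0" "l \<noteq> 0" "l \<noteq> 1"
  shows "p = 0" "q = 0" "r = 0"
proof -
  have X0: "X 0 = 0" using scale[of 0 0] by simp
  have 1: "p + l *s r = 0"
    using X0 assms(6) add[of "p + q" r] add[of p q] assms(3-5) by simp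
  then have "X (p + l *s r) = 0" using X0 by simp
  then have 2: "p + l *s (l *s r) = 0"
    by (simp add: add scale assms(3,5))
  have "(l * (l - 1)) *s r = (p + l *s (l *s r)) - (p + l *s r)"
    by (simp add: algebra_simps scale_left_diff_distrib)
  then have "(l * (l - 1)) *s r = 0" using 1 2 by simp
  then show r: "r = 0" using assms(7,8) by simp
  from 1 r show p: "p = 0" by simp
  from p r assms(6) show "q = 0" by simp
qed

lemma two_sided_decomposition_exists:
  assumes ax: "axis_of_type a l d"
  shows "\<exists>\<alpha> x00 x0d xl0 xld. two_sided_decomposition a l d x \<alpha> x00 x0d xl0 xld"
proof -
  have left: "one_sided_axis (Lmul a) a l" and right: "one_sided_axis (Rmul a) a d"
    and comm: "\<And>x. Lmul a (Rmul a x) = Rmul a (Lmul a x)"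
    using ax unfolding axis_of_type_def left_axis_def right_axis_def
    by (auto simp: fun_eq_iff)
  have idem: "a \<cdot> a = a" and d: "d \<noteq> 0" "d \<noteq> 1" and l: "l \<noteq> 0" "l \<noteq> 1"
    using left right unfolding one_sided_axis_def by auto
  have split: "\<exists>u v. u \<in> eigenspace2 a k 0 \<and> v \<in> eigenspace2 a k d \<and> w = u + v"
    if w: "w \<in> eigenspace (Lmul a) k" and k: "k \<noteq> 1" for w k
  proof -
    obtain \<beta> u v where u: "u \<in> eigenspace (Rmul a) 0" and v: "v \<in> eigenspace (Rmul a) d"
      and weq: "w = \<beta> *s a + u + v"
      using one_sided_axis_decompose[OF right] by blast
    define D where "D x = Lmul a x + (- k) *s x" for x
    have D_add: "D (x + y) = D x + D y" for x y
      by (simp add: D_def Lmul_linear scale_right_distrib algebra_simps)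
    have D_R: "Rmul a (D x) = D (Rmul a x)" for x
      by (simp add: D_def Rmul_linear Lmul_linear comm del: scale_minus_left)
    have D_scale: "D (c *s x) = c *s D x" for c x
      by (simp add: D_def Lmul_linear scale_right_distrib mult.commute del: scale_minus_left)
    have Ra: "Rmul a a = a" using idem by (simp add: Rmul_def)
    have 0: "D (\<beta> *s a) + D u + D v = 0"
    proof -
      have "D w = 0" using w by (simp add: eigenspace_def D_def)
      then show ?thesis using weq by (simp add: D_add)
    qed
    have D0: "D 0 = 0" using D_scale[of 0 0] by simp
    note z = eigen_sum_zero[where X = "Rmul a", OF Rmul_linear _ _ _ 0 d]
    have p: "Rmul a (D (\<beta> *s a)) = D (\<beta> *s a)" by (simp add: D_R Rmul_linear Ra)
    have q: "Rmul a (D u) = 0" using u by (simp add: D_R eigenspace_def D0)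
    have r: "Rmul a (D v) = d *s D v" using v by (simp add: D_R eigenspace_def D_scale)
    have Dz: "D (\<beta> *s a) = 0" "D u = 0" "D v = 0" using z[OF p q r] by auto
    have "D (\<beta> *s a) = (\<beta> * (1 - k)) *s a"
      using idem by (simp add: D_def Lmul_def mult_scale_right algebra_simps scale_left_diff_distrib)
    then have "\<beta> *s a = 0" using Dz(1) k by auto
    then have "w = u + v" using weq by simp
    moreover have "u \<in> eigenspace2 a k 0" "v \<in> eigenspace2 a k d"
      using u v Dz by (auto simp: eigenspace2_def eigenspace_def D_def)
    ultimately show ?thesis by blast
  qed
  obtain \<alpha> u v where u: "u \<in> eigenspace (Lmul a) 0" and v: "v \<in> eigenspace (Lmul a) l"
    and x: "x = \<alpha> *s a + u + v"
    using one_sided_axis_decompose[OF left] by blast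
  from split[OF u] obtain u0 ud where "u0 \<in> eigenspace2 a 0 0" "ud \<in> eigenspace2 a 0 d"
    "u = u0 + ud" by auto
  moreover from split[OF v l(2)] obtain v0 vd where "v0 \<in> eigenspace2 a l 0"
    "vd \<in> eigenspace2 a l d" "v = v0 + vd" by auto
  ultimately have "two_sided_decomposition a l d x \<alpha> u0 ud v0 vd"
    using x by (simp add: two_sided_decomposition_def ac_simps)
  then show ?thesis by blast
qed

lemma two_sided_decomposition_unique:
  assumes ax: "axis_of_type a l d"
    and D1: "two_sided_decomposition a l d x \<alpha> x00 x0d xl0 xld"
    and D2: "two_sided_decomposition a l d x \<beta> y00 y0d yl0 yld"
  shows "\<alpha> *s a = \<beta> *s a" "x00 = y00" "x0d = y0d" "xl0 = yl0" "xld = yld"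
proof -
  have idem: "a \<cdot> a = a" and d: "d \<noteq> 0" "d \<noteq> 1" and l: "l \<noteq> 0" "l \<noteq> 1"
    using ax unfolding axis_of_type_def left_axis_def right_axis_def one_sided_axis_def by auto
  have sub: "u - v \<in> eigenspace2 a k m"
    if "u \<in> eigenspace2 a k m" "v \<in> eigenspace2 a k m" for u v k m
  proof -
    have "Lmul a (u - v) = Lmul a u - Lmul a v" "Rmul a (u - v) = Rmul a u - Rmul a v"
      using Lmul_linear(1)[of a "u - v" v] Rmul_linear(1)[of a "u - v" v] by simp_all
    with that show ?thesis by (simp add: eigenspace2_def eigenspace_def scale_right_diff_distrib)
  qed
  define p q r s where "p = x00 - y00" and "q = x0d - y0d" and "r = xl0 - yl0" and "s = xld - yld"
  have mem: "p \<in> eigenspace2 a 0 0" "q \<in> eigenspace2 a 0 d" "r \<in> eigenspace2 a l 0"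
    "s \<in> eigenspace2 a l d"
    using D1 D2 sub unfolding p_def q_def r_def s_def two_sided_decomposition_def by blast+
  define c where "c = (\<alpha> - \<beta>) *s a"
  have "\<alpha> *s a + x00 + x0d + xl0 + xld = \<beta> *s a + y00 + y0d + yl0 + yld"
    using D1 D2 unfolding two_sided_decomposition_def by simp
  then have sum: "c + (p + q) + (r + s) = 0"
    by (simp add: c_def p_def q_def r_def s_def scale_left_diff_distrib algebra_simps)
  have Lc: "Lmul a c = c" using idem by (simp add: c_def Lmul_linear) (simp add: Lmul_def)
  have Lpq: "Lmul a (p + q) = 0" and Lrs: "Lmul a (r + s) = l *s (r + s)"
    using mem by (auto simp: Lmul_linear eigenspace2_def eigenspace_def scale_right_distrib)
  note z = eigen_sum_zero[where X = "Lmul a", OF Lmul_linear Lc Lpq Lrs sum l]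
  have R0: "Rmul a 0 = 0" using Rmul_linear(2)[of a 0 0] by simp
  have "Rmul a (p + q) = d *s q" "Rmul a (r + s) = d *s s"
    using mem by (auto simp: Rmul_linear eigenspace2_def eigenspace_def)
  then have "q = 0" "s = 0" using z R0 d by auto
  moreover then have "p = 0" "r = 0" using z by auto
  ultimately show "x00 = y00" "x0d = y0d" "xl0 = yl0" "xld = yld"
    by (simp_all add: p_def q_def r_def s_def)
  show "\<alpha> *s a = \<beta> *s a" using z(1) by (simp add: c_def scale_left_diff_distrib)
qed

lemma ex1_component_ld:
  assumes "axis_of_type a l d"
  shows "\<exists>!xld. \<exists>\<alpha> x00 x0d xl0. two_sided_decomposition a l d x \<alpha> x00 x0d xl0 xld"
proof (rule ex_ex1I)
  show "\<exists>xld \<alpha> x00 x0d xl0. two_sided_decomposition a l d x \<alpha> x00 x0d xl0 xld"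
    using two_sided_decomposition_exists[OF assms, of x] by metis
next
  fix u v
  assume "\<exists>\<alpha> x00 x0d xl0. two_sided_decomposition a l d x \<alpha> x00 x0d xl0 u"
    and "\<exists>\<alpha> x00 x0d xl0. two_sided_decomposition a l d x \<alpha> x00 x0d xl0 v"
  then show "u = v"
    by (elim exE) (rule two_sided_decomposition_unique(5)[OF assms])
qed

end

end

theory Submission
  imports Defs
begin

text \<open>Comparing \<open>ab\<close> with \<open>ba\<close> in the 2-sided decomposition of \<open>b\<close> shows that for
  \<open>\<lambda> \<noteq> \<delta>\<close> only \<open>b = \<alpha>a + b\<^sub>0\<^sub>0\<close> is possible, so \<open>ab = \<alpha>a\<close>. Now exchange the roles: \<open>a\<close> is an
  idempotent eigenvector of the left multiplication by the axis \<open>b\<close>. It cannot lie in the minus part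
  of the grading, because \<open>a = aa\<close> would then lie in the plus part as well; so the eigenvalue is
  \<open>0\<close>, or it is \<open>1\<close> and \<open>a\<close> is an idempotent multiple of \<open>b\<close>.\<close>

context nonassoc_algebra
begin

lemma mult_zero_right [simp]: "x \<cdot> 0 = 0"
  using mult_scale_right[of x 0 0] by simp

lemma mult_zero_left [simp]: "0 \<cdot> x = 0"
  using mult_scale_left[of 0 0 x] by simp

lemma eigenspace2_iff: "v \<in> eigenspace2 a l d \<longleftrightarrow> a \<cdot> v = l *s v \<and> v \<cdot> a = d *s v"
  by (simp add: eigenspace2_def eigenspace_def Lmul_def Rmul_def)

lemma axis_of_typeD:
  assumes "axis_of_type a l d"
  shows "left_axis a l" "a \<cdot> a = a" "l \<noteq> 0" "d \<noteq> 0"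
  using assms
  by (auto simp: axis_of_type_def left_axis_def right_axis_def one_sided_axis_def)

lemma left_axis_idempotent_eigenvector:
  assumes ax: "left_axis b l" and idem: "e \<cdot> e = e" and ev: "b \<cdot> e = c *s e"
  shows "b \<cdot> e = 0 \<or> e = b"
proof (cases "e = 0")
  case True
  then show ?thesis by simp
next
  case False
  have bb: "b \<cdot> b = b"
    and E1: "eigenspace (Lmul b) 1 = range (\<lambda>c. c *s b)"
    and poly: "(\<lambda>v. Lmul b v - l *s v) \<circ> (\<lambda>v. Lmul b v - v) \<circ> Lmul b = (\<lambda>v. 0)"
    and gr: "Z2_grading (eigenspace (Lmul b) 0 + eigenspace (Lmul b) 1) (eigenspace (Lmul b) l)"
    using ax unfolding left_axis_def one_sided_axis_def by auto
  \<comment> \<open>The cubic that annihilates \<open>Lmul b\<close> acts on the eigenvector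
    \<open>e\<close> as this scalar. Since \<open>e\<close> is nonzero, \<open>c\<close> must be one
    of the three roots.\<close>
  have "((c - l) * ((c - 1) * c)) *s e = 0"
  proof -
    have L: "Lmul b (k *s e) = (k * c) *s e" for k
      using ev by (simp add: Lmul_def mult_scale_right)
    have "Lmul b e = c *s e"
      using ev by (simp add: Lmul_def)
    moreover have "Lmul b (c *s e) - c *s e = ((c - 1) * c) *s e"
      by (simp add: L algebra_simps scale_left_diff_distrib)
    moreover have "Lmul b (k *s e) - l *s k *s e = ((c - l) * k) *s e" for k
      by (simp add: L algebra_simps scale_left_diff_distrib)
    ultimately show ?thesis
      using fun_cong[OF poly, of e] by simp
  qed
  then consider "c = 0" | "c = 1" | "c = l"
    using False by auto
  then show ?thesis
  proof cases
    case 1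
    then show ?thesis using ev by simp
  next
    case 2
    then have "e \<in> eigenspace (Lmul b) 1"
      using ev by (simp add: eigenspace_def Lmul_def)
    then obtain k where k: "e = k *s b"
      using E1 by auto
    have "b \<cdot> e = e"
      using ev 2 by simp
    \<comment> \<open>Pulling \<open>k\<close> out of the left factor \<open>k *s b\<close> leaves
      \<open>b \<cdot> e = e\<close>. As \<open>e\<close> is a nonzero idempotent, this forces
      \<open>k = 1\<close>.\<close>
    then have "e \<cdot> e = k *s e"
      using k by (metis mult_scale_left)
    then have "(k - 1) *s e = 0"
      using idem by (simp add: scale_left_diff_distrib)
    then show ?thesis
      using k False by auto
  next
    case 3
    then have "e \<in> eigenspace (Lmul b) l"
      using ev by (simp add: eigenspace_def Lmul_def)
    then have "e \<in> (eigenspace (Lmul b) 0 + eigenspace (Lmul b) 1) \<inter> eigenspace (Lmul b) l"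
      using gr idem unfolding Z2_grading_def by (metis IntI)
    then have "e = 0"
      using gr unfolding Z2_grading_def internal_direct_sum_def by blast
    then show ?thesis using False by simp
  qed
qed

lemma component_ld_eqI:
  assumes "axis_of_type a l d" and "two_sided_decomposition a l d x \<alpha> x00 x0d xl0 xld"
  shows "component_ld a l d x = xld"
  unfolding component_ld_def
  using ex1_component_ld[OF assms(1), of x] assms(2) by (intro the1_equality) blast+

text \<open>Left and right multiplication by \<open>a\<close> scale each component of
  \<open>b\<close> by its left and right eigenvalue. When the two products agree, uniqueness of the
  decomposition kills every component on which these eigenvalues differ.\<close>

lemma commuting_decomposition:
  assumes ax: "axis_of_type a l d" and comm: "a \<cdot> b = b \<cdot> a"
    and dec: "two_sided_decomposition a l d b \<alpha> b00 b0d bl0 bld"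
  shows "b0d = 0" "bl0 = 0" "l \<noteq> d \<Longrightarrow> bld = 0"
proof -
  note axD = axis_of_typeD[OF ax]
  have mem: "b00 \<in> eigenspace2 a 0 0" "b0d \<in> eigenspace2 a 0 d"
    "bl0 \<in> eigenspace2 a l 0" "bld \<in> eigenspace2 a l d"
    and b: "b = \<alpha> *s a + b00 + b0d + bl0 + bld"
    using dec by (auto simp: two_sided_decomposition_def)
  \<comment> \<open>The explicit zeros hold the places of the annihilated components, so that both
    products already have the shape of a 2-sided decomposition.\<close>
  have "a \<cdot> b = \<alpha> *s a + 0 + 0 + l *s bl0 + l *s bld"
    and "b \<cdot> a = \<alpha> *s a + 0 + d *s b0d + 0 + d *s bld"
    using mem axD(2) unfolding b
    by (simp_all add: eigenspace2_iff mult_add_left mult_add_right mult_scale_left mult_scale_right)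
  then have "two_sided_decomposition a l d (a \<cdot> b) \<alpha> 0 0 (l *s bl0) (l *s bld)"
    and "two_sided_decomposition a l d (a \<cdot> b) \<alpha> 0 (d *s b0d) 0 (d *s bld)"
    using mem comm
    by (simp_all add: two_sided_decomposition_def eigenspace2_iff
        mult_scale_left mult_scale_right mult.commute)
  note uniq = two_sided_decomposition_unique[OF ax this]
  show "b0d = 0" "bl0 = 0"
    using uniq axD by auto
  show "bld = 0" if "l \<noteq> d"
    using uniq(5) that by simp
qed

text \<open>For Jordan type only multiples of \<open>a\<close>, \<open>A_{0,0}\<close> and
  \<open>A_{l,d}\<close> remain. On the first two, left and right multiplication by \<open>a\<close>
  agree; on the third they are the scalars \<open>l\<close> and \<open>d\<close>.\<close>

lemma jordan_type_central_iff:
  assumes ax: "axis_of_jordan_type a l d"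
  shows "a \<in> commutative_center \<longleftrightarrow> eigenspace2 a l d = {0} \<or> l = d"
proof
  assume "a \<in> commutative_center"
  then have comm: "a \<cdot> v = v \<cdot> a" for v
    by (simp add: commutative_center_def)
  have "v = 0" if "v \<in> eigenspace2 a l d" "l \<noteq> d" for v
    using that comm[of v] by (metis eigenspace2_iff scale_right_imp_eq)
  moreover have "0 \<in> eigenspace2 a l d"
    by (simp add: eigenspace2_iff)
  ultimately show "eigenspace2 a l d = {0} \<or> l = d"
    by blast
next
  assume *: "eigenspace2 a l d = {0} \<or> l = d"
  have type: "axis_of_type a l d" and J: "eigenspace2 a l 0 = {0}" "eigenspace2 a 0 d = {0}"
    using ax by (auto simp: axis_of_jordan_type_def)
  have "a \<cdot> x = x \<cdot> a" for x
  proof -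
    obtain \<alpha> x00 x0d xl0 xld where "two_sided_decomposition a l d x \<alpha> x00 x0d xl0 xld"
      using two_sided_decomposition_exists[OF type] by blast
    then have mem: "x00 \<in> eigenspace2 a 0 0" "xld \<in> eigenspace2 a l d"
      and x: "x = \<alpha> *s a + x00 + xld"
      using J by (auto simp: two_sided_decomposition_def)
    \<comment> \<open>Both alternatives are used only through this equation: either
      \<open>xld\<close> vanishes or the scalars coincide.\<close>
    have "l *s xld = d *s xld"
      using * mem(2) by auto
    then show ?thesis
      using mem unfolding x
      by (simp add: eigenspace2_iff mult_add_left mult_add_right mult_scale_left mult_scale_right)
  qed
  then show "a \<in> commutative_center"
    by (simp add: commutative_center_def)
qed

lemma commuting_axes:
  assumes ax: "axis_of_type a l d" and b: "axis b" and "a \<noteq> b" and comm: "a \<cdot> b = b \<cdot> a"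
    and "l \<noteq> d"
  shows "a \<cdot> b = 0" "component_ld a l d b = 0"
proof -
  obtain \<alpha> b00 b0d bl0 bld where dec: "two_sided_decomposition a l d b \<alpha> b00 b0d bl0 bld"
    using two_sided_decomposition_exists[OF ax] by blast
  note zero = commuting_decomposition[OF ax comm dec]
  show "component_ld a l d b = 0"
    using component_ld_eqI[OF ax dec] zero(3) \<open>l \<noteq> d\<close> by simp
  have "b = \<alpha> *s a + b00" "b00 \<in> eigenspace2 a 0 0"
    using dec zero \<open>l \<noteq> d\<close> by (auto simp: two_sided_decomposition_def)
  \<comment> \<open>Here the roles change: \<open>a\<close> becomes an idempotent eigenvector for
    the axis \<open>b\<close>, with eigenvalue \<alpha>.\<close>
  then have "b \<cdot> a = \<alpha> *s a"
    using axis_of_typeD(2)[OF ax]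
    by (simp add: eigenspace2_iff mult_add_left mult_scale_left)
  moreover obtain m where "left_axis b m"
    using b axis_of_typeD(1) by (auto simp: axis_def)
  ultimately show "a \<cdot> b = 0"
    using left_axis_idempotent_eigenvector axis_of_typeD(2)[OF ax] \<open>a \<noteq> b\<close> comm by metis
qed

end

theorem propositionB:
  fixes scale :: "'f::field \<Rightarrow> 'a::ab_group_add \<Rightarrow> 'a"
    and mult :: "'a \<Rightarrow> 'a \<Rightarrow> 'a" (infixl \<open>\<cdot>\<close> 70)
  assumes "nonassoc_algebra scale mult"
    and "CHAR('f) \<noteq> 2"
  shows
    "(\<forall>a l d. nonassoc_algebra.axis_of_jordan_type scale mult a l d \<longrightarrow>
       (a \<in> nonassoc_algebra.commutative_center mult \<longleftrightarrow>
        nonassoc_algebra.eigenspace2 scale mult a l d = {0} \<or> l = d)) \<and>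
     (\<forall>a b l d. nonassoc_algebra.axis_of_type scale mult a l d \<and>
         nonassoc_algebra.axis scale mult b \<and> a \<noteq> b \<and> a \<cdot> b = b \<cdot> a \<longrightarrow>
       (a \<cdot> b = 0 \<and> nonassoc_algebra.component_ld scale mult a l d b = 0 \<or> l = d) \<and>
       (nonassoc_algebra.axis_of_jordan_type scale mult a l d \<longrightarrow>
        a \<in> nonassoc_algebra.commutative_center mult \<or> a \<cdot> b = 0))"
proof -
  interpret nonassoc_algebra scale mult by fact
  have jordan: "a \<in> commutative_center \<longleftrightarrow> eigenspace2 a l d = {0} \<or> l = d"
    if "axis_of_jordan_type a l d" for a l d
    using jordan_type_central_iff[OF that] .
  have commuting: "a \<cdot> b = 0 \<and> component_ld a l d b = 0 \<or> l = d"
    if "axis_of_type a l d" "axis b" "a \<noteq> b" "a \<cdot> b = b \<cdot> a" for a b l d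
    using commuting_axes[OF that] by blast
  show ?thesis
    \<comment> \<open>For the last claim, \<open>l = d\<close> makes a Jordan type \<open>a\<close>
      central by the first part; otherwise \<open>a \<cdot> b = 0\<close>.\<close>
    using jordan commuting by blast
qed

end
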